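(* Let $\mathcal H_A$ and $\mathcal H_B$ be finite-dimensional complex Hilbert spaces, let $\Phi:\mathcal L(\mathcal H_A)\to\mathcal L(\mathcal H_B)$ be a completely positive trace-preserving linear map, let $\mathcal C\subseteq\mathcal H_A$ be a nonzero subspace, and let $P_{\mathcal C}$ be the orthogonal projection of $\mathcal H_A$ onto $\mathcal C$. Then the following two conditions are equivalent: (i) $\mathcal C$ is private for $\Phi$, i.e. there is a density operator $\rho_0\in\mathcal L(\mathcal H_B)$ (the output state) such that $\Phi(\rho)=\rho_0$ for every density operator $\rho\in\mathcal L(\mathcal C)$; (ii) for every $X\in\mathcal L(\mathcal H_B)$ there exists a scalar $\lambda_X\in\mathbb C$ such that $$P_{\mathcal C}\,\Phi^\dagger(X)\,P_{\mathcal C}=\lambda_X P_{\mathcal C}.$$ Moreover, when these conditions hold, with $\rho_0$ the output state in (i), one has $\lambda_X=\operatorname{Tr}(\rho_0 X)$ for every $X\in\mathcal L(\mathcal H_B)$.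
   Context: $\mathcal L(\mathcal H)$ denotes the set of all linear operators on a finite-dimensional complex Hilbert space $\mathcal H$. A density operator is a positive semidefinite operator of trace one. For a subspace $\mathcal C\subseteq\mathcal H_A$, $\mathcal L(\mathcal C)$ is regarded as a subset of $\mathcal L(\mathcal H_A)$, namely the operators $Y\in\mathcal L(\mathcal H_A)$ with $Y=P_{\mathcal C}YP_{\mathcal C}$. The dual map $\Phi^\dagger:\mathcal L(\mathcal H_B)\to\mathcal L(\mathcal H_A)$ of a linear map $\Phi:\mathcal L(\mathcal H_A)\to\mathcal L(\mathcal H_B)$ is the unique linear map satisfying $\operatorname{Tr}(\rho\,\Phi^\dagger(X))=\operatorname{Tr}(\Phi(\rho)X)$ for all $X\in\mathcal L(\mathcal H_B)$ and all $\rho\in\mathcal L(\mathcal H_A)$. *)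

theory Defs
  imports "HOL-Analysis.Analysis"
begin

section \<open>Finite-dimensional complex Hilbert spaces\<close>

class complex_vector = ab_group_add +
  fixes scaleC :: "complex \<Rightarrow> 'a \<Rightarrow> 'a"  (infixr \<open>*\<^sub>C\<close> 75)
  assumes scaleC_add_right: "a *\<^sub>C (x + y) = a *\<^sub>C x + a *\<^sub>C y"
    and scaleC_add_left: "(a + b) *\<^sub>C x = a *\<^sub>C x + b *\<^sub>C x"
    and scaleC_scaleC: "a *\<^sub>C b *\<^sub>C x = (a * b) *\<^sub>C x"
    and scaleC_one: "1 *\<^sub>C x = x"

global_interpretation complex_vector: vector_space "scaleC :: complex \<Rightarrow> 'a \<Rightarrow> 'a::complex_vector"
  by standard (simp_all add: scaleC_add_right scaleC_add_left scaleC_scaleC scaleC_one)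

abbreviation "csubspace \<equiv> module.subspace (scaleC :: complex \<Rightarrow> 'a \<Rightarrow> 'a::complex_vector)"
abbreviation "cspan \<equiv> module.span (scaleC :: complex \<Rightarrow> 'a \<Rightarrow> 'a::complex_vector)"
abbreviation "clinear \<equiv> Vector_Spaces.linear
    (scaleC :: complex \<Rightarrow> 'a \<Rightarrow> 'a::complex_vector) (scaleC :: complex \<Rightarrow> 'b \<Rightarrow> 'b::complex_vector)"

text \<open>The inner product is conjugate-linear in the first argument. Completeness is automatic
  in finite dimension, so it is not an axiom.\<close>

class fd_hilbert = complex_vector +
  fixes cinner :: "'a \<Rightarrow> 'a \<Rightarrow> complex"
  assumes cinner_commute: "cinner x y = cnj (cinner y x)"
    and cinner_add_right: "cinner x (y + z) = cinner x y + cinner x z"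
    and cinner_scaleC_right: "cinner x (a *\<^sub>C y) = a * cinner x y"
    and cinner_nonneg: "0 \<le> Re (cinner x x)"
    and cinner_eq_zero_iff: "cinner x x = 0 \<longleftrightarrow> x = 0"
    and finite_dim: "\<exists>B. finite B \<and> (\<forall>x. \<exists>c. x = (\<Sum>b\<in>B. c b *\<^sub>C b))"

definition orthonormal :: "'a::fd_hilbert set \<Rightarrow> bool" where
  "orthonormal B \<longleftrightarrow> (\<forall>x\<in>B. \<forall>y\<in>B. cinner x y = (if x = y then 1 else 0))"

definition is_onb :: "'a::fd_hilbert set \<Rightarrow> bool" where
  "is_onb B \<longleftrightarrow> finite B \<and> orthonormal B \<and> cspan B = UNIV"

section \<open>The algebra of linear operators on a space\<close>

typedef (overloaded) 'a linop = "{f :: 'a::complex_vector \<Rightarrow> 'a. clinear f}"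
  morphisms app Linop
proof
  show "id \<in> {f :: 'a \<Rightarrow> 'a. clinear f}"
    by (simp add: complex_vector.linear_id)
qed

setup_lifting type_definition_linop

lemma clinear_app: "clinear (app T)"
  using app[of T] by simp

lemma clinear_iff: "clinear f \<longleftrightarrow> (\<forall>x y. f (x + y) = f x + f y) \<and> (\<forall>c x. f (c *\<^sub>C x) = c *\<^sub>C f x)"
  by (simp add: Vector_Spaces.linear_iff complex_vector.vector_space_axioms)

text \<open>Multiplication of operators is composition.\<close>

instantiation linop :: (complex_vector) "{ring, complex_vector}"
begin

lift_definition zero_linop :: "'a linop" is "\<lambda>x. 0"
  by (simp add: clinear_iff)
lift_definition plus_linop :: "'a linop \<Rightarrow> 'a linop \<Rightarrow> 'a linop" is "\<lambda>S T x. S x + T x"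
  by (simp add: clinear_iff scaleC_add_right)
lift_definition uminus_linop :: "'a linop \<Rightarrow> 'a linop" is "\<lambda>T x. - T x"
  by (simp add: clinear_iff)
lift_definition minus_linop :: "'a linop \<Rightarrow> 'a linop \<Rightarrow> 'a linop" is "\<lambda>S T x. S x - T x"
  by (simp add: clinear_iff complex_vector.scale_right_diff_distrib)
lift_definition times_linop :: "'a linop \<Rightarrow> 'a linop \<Rightarrow> 'a linop" is "\<lambda>S T x. S (T x)"
  by (simp add: clinear_iff)
lift_definition scaleC_linop :: "complex \<Rightarrow> 'a linop \<Rightarrow> 'a linop" is "\<lambda>c T x. c *\<^sub>C T x"
  by (simp add: clinear_iff scaleC_add_right scaleC_scaleC mult.commute)

instance
proof
  fix a b c :: "'a linop" and r s :: complex
  show "a * b * c = a * (b * c)" by transfer simp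
  show "a + b + c = a + (b + c)" by transfer (simp add: add.assoc)
  show "a + b = b + a" by transfer (simp add: add.commute)
  show "0 + a = a" by transfer simp
  show "- a + a = 0" by transfer simp
  show "a - b = a + - b" by transfer simp
  show "(a + b) * c = a * c + b * c" by transfer simp
  show "a * (b + c) = a * b + a * c" by transfer (simp add: clinear_iff)
  show "r *\<^sub>C (a + b) = r *\<^sub>C a + r *\<^sub>C b" by transfer (simp add: scaleC_add_right)
  show "(r + s) *\<^sub>C a = r *\<^sub>C a + s *\<^sub>C a" by transfer (simp add: scaleC_add_left)
  show "r *\<^sub>C s *\<^sub>C a = (r * s) *\<^sub>C a" by transfer (simp add: scaleC_scaleC)
  show "1 *\<^sub>C a = a" by transfer (simp add: scaleC_one)
qed

end

definition op_trace :: "'a::fd_hilbert linop \<Rightarrow> complex" where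
  "op_trace T = (let B = (SOME B. is_onb B) in \<Sum>e\<in>B. cinner e (app T e))"

definition psd :: "'a::fd_hilbert linop \<Rightarrow> bool" where
  "psd T \<longleftrightarrow> (\<forall>x. cinner x (app T x) \<in> \<real>\<^sub>\<ge>\<^sub>0)"

definition density_op :: "'a::fd_hilbert linop \<Rightarrow> bool" where
  "density_op \<rho> \<longleftrightarrow> psd \<rho> \<and> op_trace \<rho> = 1"

definition orth_proj :: "'a::fd_hilbert set \<Rightarrow> 'a linop" where
  "orth_proj C = (THE P. \<forall>x. app P x \<in> C \<and> (\<forall>z\<in>C. cinner z (x - app P x) = 0))"

definition ops_on :: "'a::fd_hilbert set \<Rightarrow> 'a linop set" where
  "ops_on C = {Y. Y = orth_proj C * Y * orth_proj C}"

section \<open>Channels, dual maps and private subspaces\<close>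

text \<open>An operator on \<open>H \<otimes> \<complex>\<^sup>k\<close> is written as \<open>\<Sum>\<^sub>i\<^sub>j T i j \<otimes> |i\<rangle>\<langle>j|\<close>, i.e. as a
  \<open>k \<times> k\<close> block matrix of operators on \<open>H\<close> acting on \<open>H\<^sup>k\<close>; a map \<open>\<Phi> \<otimes> id\<close> then acts
  entrywise. Only the entries of \<open>T\<close> and \<open>v\<close> with indices below \<open>k\<close> matter.\<close>

definition block_psd :: "nat \<Rightarrow> (nat \<Rightarrow> nat \<Rightarrow> 'a::fd_hilbert linop) \<Rightarrow> bool" where
  "block_psd k T \<longleftrightarrow> (\<forall>v :: nat \<Rightarrow> 'a. (\<Sum>i<k. \<Sum>j<k. cinner (v i) (app (T i j) (v j))) \<in> \<real>\<^sub>\<ge>\<^sub>0)"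

definition completely_positive :: "('a::fd_hilbert linop \<Rightarrow> 'b::fd_hilbert linop) \<Rightarrow> bool" where
  "completely_positive \<Phi> \<longleftrightarrow> (\<forall>k T. block_psd k T \<longrightarrow> block_psd k (\<lambda>i j. \<Phi> (T i j)))"

definition trace_preserving :: "('a::fd_hilbert linop \<Rightarrow> 'b::fd_hilbert linop) \<Rightarrow> bool" where
  "trace_preserving \<Phi> \<longleftrightarrow> (\<forall>X. op_trace (\<Phi> X) = op_trace X)"

definition dual_map ::
  "('a::fd_hilbert linop \<Rightarrow> 'b::fd_hilbert linop) \<Rightarrow> 'b linop \<Rightarrow> 'a linop" where
  "dual_map \<Phi> = (THE \<Psi>. clinear \<Psi> \<and> (\<forall>X \<rho>. op_trace (\<rho> * \<Psi> X) = op_trace (\<Phi> \<rho> * X)))"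

definition output_state ::
  "('a::fd_hilbert linop \<Rightarrow> 'b::fd_hilbert linop) \<Rightarrow> 'a set \<Rightarrow> 'b linop \<Rightarrow> bool" where
  "output_state \<Phi> C \<rho>\<^sub>0 \<longleftrightarrow> density_op \<rho>\<^sub>0 \<and> (\<forall>\<rho>\<in>ops_on C. density_op \<rho> \<longrightarrow> \<Phi> \<rho> = \<rho>\<^sub>0)"

definition private_subspace ::
  "('a::fd_hilbert linop \<Rightarrow> 'b::fd_hilbert linop) \<Rightarrow> 'a set \<Rightarrow> bool" where
  "private_subspace \<Phi> C \<longleftrightarrow> (\<exists>\<rho>\<^sub>0. output_state \<Phi> C \<rho>\<^sub>0)"

section \<open>Well-definedness\<close>

text \<open>The choices in the definitions above are legitimate: orthonormal bases exist, the trace does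
  not depend on the basis (\<open>op_trace_onb\<close>), and orthogonal projections and dual maps exist and are
  unique (\<open>orth_proj_ex1\<close>, \<open>dual_map_ex1\<close>).\<close>

lemma cinner_add_left: "cinner (x + y) z = cinner x z + cinner (y::'a::fd_hilbert) z"
  by (metis cinner_add_right cinner_commute complex_cnj_add)
lemma cinner_scaleC_left: "cinner (c *\<^sub>C x) (y::'a::fd_hilbert) = cnj c * cinner x y"
  by (metis cinner_commute cinner_scaleC_right complex_cnj_mult)
lemma cinner_zero_right [simp]: "cinner (x::'a::fd_hilbert) 0 = 0"
  using cinner_add_right[of x 0 0] by simp
lemma cinner_zero_left [simp]: "cinner 0 (x::'a::fd_hilbert) = 0"
  using cinner_add_left[of 0 0 x] by simp
lemma cinner_diff_right: "cinner (x::'a::fd_hilbert) (y - z) = cinner x y - cinner x z"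
  using cinner_add_right[of x "y - z" z] by simp
lemma cinner_diff_left: "cinner (x - y) (z::'a::fd_hilbert) = cinner x z - cinner y z"
  using cinner_add_left[of "x - y" y z] by simp
lemma cinner_sum_right: "cinner (x::'a::fd_hilbert) (\<Sum>i\<in>A. f i) = (\<Sum>i\<in>A. cinner x (f i))"
  by (induction A rule: infinite_finite_induct) (simp_all add: cinner_add_right)
lemma cinner_sum_left: "cinner (\<Sum>i\<in>A. f i) (x::'a::fd_hilbert) = (\<Sum>i\<in>A. cinner (f i) x)"
  by (induction A rule: infinite_finite_induct) (simp_all add: cinner_add_left)

lemma cinner_self: "cinner x x = complex_of_real (Re (cinner x (x::'a::fd_hilbert)))"
  by (metis Reals_cnj_iff cinner_commute of_real_Re)

lemma orthonormal_expansion: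
  assumes "finite E" "orthonormal E" "v \<in> cspan E"
  shows "v = (\<Sum>e\<in>E. cinner e v *\<^sub>C e)"
proof -
  obtain u where v: "v = (\<Sum>e\<in>E. u e *\<^sub>C e)"
    using assms(3) by (auto simp: complex_vector.span_finite[OF assms(1)])
  have "cinner f v = u f" if "f \<in> E" for f
  proof -
    have "cinner f v = (\<Sum>e\<in>E. u e * (if f = e then 1 else 0))"
      using assms(2) that by (simp add: v cinner_sum_right cinner_scaleC_right orthonormal_def)
    then show ?thesis using that assms(1) by (simp add: if_distrib cong: if_cong)
  qed
  then show ?thesis by (subst v) simp
qed

lemma gram_schmidt:
  assumes "finite B"
  shows "\<exists>E. finite E \<and> orthonormal E \<and> cspan E = cspan (B :: 'a::fd_hilbert set)"
  using assms
proof (induction B)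
  case empty
  then show ?case by (intro exI[of _ "{}"]) (simp add: orthonormal_def)
next
  case (insert b B)
  then obtain E where E: "finite E" "orthonormal E" "cspan E = cspan B" by blast
  define p where "p = (\<Sum>e\<in>E. cinner e b *\<^sub>C e)"
  define x where "x = b - p"
  have p: "p \<in> cspan E" unfolding p_def
    by (intro complex_vector.span_sum complex_vector.span_scale complex_vector.span_base)
  have sp: "cspan (insert b B) = cspan (insert b E)"
    by (simp add: complex_vector.span_insert E(3))
  have ort: "cinner e x = 0" if "e \<in> E" for e
  proof -
    have "cinner e p = (\<Sum>f\<in>E. cinner f b * (if e = f then 1 else 0))"
      using E(2) that by (simp add: p_def cinner_sum_right cinner_scaleC_right orthonormal_def)
    then show ?thesis using that E(1) by (simp add: x_def cinner_diff_right if_distrib cong: if_cong)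
  qed
  show ?case
  proof (cases "x = 0")
    case True
    then have "b \<in> cspan E" using p by (simp add: x_def)
    then show ?thesis using E sp by (metis complex_vector.span_redundant)
  next
    case False
    define r where "r = Re (cinner x x)"
    have rr: "cinner x x = complex_of_real r" unfolding r_def by (rule cinner_self)
    have "r \<noteq> 0" using False cinner_eq_zero_iff[of x] rr by simp
    then have "r > 0" using cinner_nonneg[of x] by (simp add: r_def less_le)
    define c where "c = complex_of_real (1 / sqrt r)"
    have c0: "c \<noteq> 0" using \<open>r > 0\<close> by (simp add: c_def)
    have n1: "cinner (c *\<^sub>C x) (c *\<^sub>C x) = 1"
    proof -
      have "cinner (c *\<^sub>C x) (c *\<^sub>C x) = cnj c * (c * complex_of_real r)"
        by (simp add: cinner_scaleC_left cinner_scaleC_right rr)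
      also have "\<dots> = complex_of_real ((1 / sqrt r) * ((1 / sqrt r) * r))"
        unfolding c_def complex_cnj_complex_of_real by (simp only: of_real_mult)
      also have "(1 / sqrt r) * ((1 / sqrt r) * r) = 1" using \<open>r > 0\<close>
        by (simp add: field_simps)
      finally show ?thesis by simp
    qed
    have o1: "cinner e (c *\<^sub>C x) = 0" if "e \<in> E" for e using ort that by (simp add: cinner_scaleC_right)
    have o2: "cinner (c *\<^sub>C x) e = 0" if "e \<in> E" for e using o1[OF that] by (metis cinner_commute complex_cnj_zero)
    have on: "orthonormal (insert (c *\<^sub>C x) E)"
      using E(2) o1 o2 n1 by (auto simp: orthonormal_def)
    have "cspan (insert (c *\<^sub>C x) E) = cspan (insert b E)"
    proof -
      have pi: "p \<in> cspan (insert y E)" for y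
        using p complex_vector.span_mono[of E "insert y E"] by blast
      have yi: "y \<in> cspan (insert y E)" for y
        by (rule complex_vector.span_base) simp
      have sub: "cspan (insert y E) \<subseteq> cspan (insert z E)" if "y \<in> cspan (insert z E)" for y z
        using that complex_vector.span_base[of _ "insert z E"]
        by (intro complex_vector.span_minimal complex_vector.subspace_span) auto
      have m: "x \<in> cspan (insert b E)" unfolding x_def
        by (rule complex_vector.span_diff[OF yi pi])
      have "b = (1/c) *\<^sub>C (c *\<^sub>C x) + p" using c0 by (simp add: x_def scaleC_scaleC scaleC_one)
      moreover have "\<dots> \<in> cspan (insert (c *\<^sub>C x) E)"
        by (intro complex_vector.span_add complex_vector.span_scale yi pi)
      ultimately have b: "b \<in> cspan (insert (c *\<^sub>C x) E)" by simp
      show ?thesis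
        by (rule subset_antisym[OF sub[OF complex_vector.span_scale[OF m]] sub[OF b]])
    qed
    then show ?thesis using on E(1) sp by (intro exI[of _ "insert (c *\<^sub>C x) E"]) simp
  qed
qed

lemma finite_cspan: "\<exists>B::'a::fd_hilbert set. finite B \<and> cspan B = UNIV"
proof -
  obtain B :: "'a set" where "finite B" "\<forall>x. \<exists>c. x = (\<Sum>b\<in>B. c b *\<^sub>C b)" using finite_dim by blast
  then show ?thesis by (intro exI[of _ B]) (auto simp: complex_vector.span_finite)
qed

lemma onb_of_subspace:
  assumes "csubspace (C :: 'a::fd_hilbert set)"
  shows "\<exists>E. finite E \<and> orthonormal E \<and> cspan E = C"
proof -
  obtain B where B: "B \<subseteq> C" "C \<subseteq> cspan B" "\<not> complex_vector.dependent B"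
    using complex_vector.maximal_independent_subset by metis
  obtain D :: "'a set" where "finite D" "cspan D = UNIV" using finite_cspan by blast
  then have "finite B" using complex_vector.independent_span_bound[of D B] B by auto
  moreover have "cspan B = C" using B assms by (metis complex_vector.span_minimal subset_antisym)
  ultimately show ?thesis using gram_schmidt by metis
qed

lemma onb_exists: "\<exists>B::'a::fd_hilbert set. is_onb B"
  using onb_of_subspace[OF complex_vector.subspace_UNIV]
  unfolding is_onb_def by metis

lemma onb_expansion: "is_onb E \<Longrightarrow> (v::'a::fd_hilbert) = (\<Sum>e\<in>E. cinner e v *\<^sub>C e)"
  by (rule orthonormal_expansion) (auto simp: is_onb_def)

lemma app_add [simp]: "app T (x + y) = app T x + app T y"
  and app_scaleC [simp]: "app T (c *\<^sub>C x) = c *\<^sub>C app T x"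
  using clinear_app[of T] by (auto simp: clinear_iff)

lemma app_sum: "app T (\<Sum>i\<in>A. f i) = (\<Sum>i\<in>A. app T (f i))"
proof -
  have z: "app T 0 = 0" using app_scaleC[of T 0 0] by simp
  show ?thesis
    by (induction A rule: infinite_finite_induct) (simp_all add: z)
qed

lemma onb_trace_swap:
  assumes "is_onb E" "is_onb F"
  shows "(\<Sum>e\<in>E. cinner e (app T (app S e))) = (\<Sum>f\<in>F. cinner f (app S (app T f)))"
proof -
  have "cinner e (app T (app S e)) = (\<Sum>f\<in>F. cinner f (app S e) * cinner e (app T f))" for e
    by (subst onb_expansion[OF assms(2), of "app S e"])
      (simp add: app_sum cinner_sum_right cinner_scaleC_right)
  moreover have "cinner f (app S (app T f)) = (\<Sum>e\<in>E. cinner f (app S e) * cinner e (app T f))" for f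
    by (subst onb_expansion[OF assms(1), of "app T f"])
      (simp add: app_sum cinner_sum_right cinner_scaleC_right mult.commute)
  ultimately show ?thesis by (simp only:) (rule sum.swap)
qed

lemma op_trace_onb:
  assumes "is_onb (E :: 'a::fd_hilbert set)"
  shows "op_trace T = (\<Sum>e\<in>E. cinner e (app T e))"
proof -
  have i: "app (Linop (\<lambda>x. x)) x = x" for x :: 'a
    by (subst Linop_inverse) (auto simp: clinear_iff)
  have "is_onb (SOME B :: 'a set. is_onb B)" using onb_exists by (rule someI_ex)
  from onb_trace_swap[OF this assms, of T "Linop (\<lambda>x. x)"] show ?thesis
    by (simp add: op_trace_def i Let_def)
qed

lemma app_times: "app (S * T) x = app S (app T x)" by transfer simp
lemma app_plus: "app (S + T) x = app S x + app T x" by transfer simp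
lemma app_scale: "app (c *\<^sub>C T) x = c *\<^sub>C app T x" by transfer simp

lemma linop_eqI: "(\<And>x. app S x = app T x) \<Longrightarrow> S = T"
  by (metis app_inject ext)

lemma orth_proj_ex1:
  assumes "csubspace (C :: 'a::fd_hilbert set)"
  shows "\<exists>!P. \<forall>x. app P x \<in> C \<and> (\<forall>z\<in>C. cinner z (x - app P x) = 0)"
proof -
  obtain E where E: "finite E" "orthonormal E" "cspan E = C" using onb_of_subspace[OF assms] by blast
  have a: "app (Linop (\<lambda>x. \<Sum>e\<in>E. cinner e x *\<^sub>C e)) x = (\<Sum>e\<in>E. cinner e x *\<^sub>C e)" for x
    by (subst Linop_inverse) (auto simp: clinear_iff cinner_add_right scaleC_add_left sum.distrib
      cinner_scaleC_right scaleC_scaleC complex_vector.scale_sum_right)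
  have "cinner z (x - (\<Sum>e\<in>E. cinner e x *\<^sub>C e)) = 0" if "z \<in> C" for z x
  proof -
    have z: "z = (\<Sum>e\<in>E. cinner e z *\<^sub>C e)" using orthonormal_expansion E that by blast
    have "cinner z x = (\<Sum>e\<in>E. cnj (cinner e z) * cinner e x)"
      by (subst z) (simp add: cinner_sum_left cinner_scaleC_left)
    moreover have "cinner z (\<Sum>e\<in>E. cinner e x *\<^sub>C e) = (\<Sum>e\<in>E. cinner e x * cinner z e)"
      by (simp add: cinner_sum_right cinner_scaleC_right)
    ultimately show ?thesis
      by (simp add: cinner_diff_right cinner_commute[of z] mult.commute)
  qed
  moreover have "(\<Sum>e\<in>E. cinner e x *\<^sub>C e) \<in> C" for x
    unfolding E(3)[symmetric]
    by (intro complex_vector.span_sum complex_vector.span_scale complex_vector.span_base)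
  ultimately have ex: "\<exists>P. \<forall>x. app P x \<in> C \<and> (\<forall>z\<in>C. cinner z (x - app P x) = 0)"
    by (intro exI[of _ "Linop (\<lambda>x. \<Sum>e\<in>E. cinner e x *\<^sub>C e)"]) (simp add: a)
  show ?thesis
  proof (rule ex_ex1I[OF ex], rule linop_eqI)
    fix P Q x
    assume P: "\<forall>x. app P x \<in> C \<and> (\<forall>z\<in>C. cinner z (x - app P x) = 0)"
      and Q: "\<forall>x. app Q x \<in> C \<and> (\<forall>z\<in>C. cinner z (x - app Q x) = 0)"
    have d: "app P x - app Q x \<in> C" using P Q assms complex_vector.subspace_diff by blast
    have "cinner (app P x - app Q x) (app P x - app Q x)
        = cinner (app P x - app Q x) (x - app Q x) - cinner (app P x - app Q x) (x - app P x)"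
      by (simp add: cinner_diff_right)
    also have "\<dots> = 0" using P Q d by simp
    finally show "app P x = app Q x" by (simp add: cinner_eq_zero_iff)
  qed
qed

lemma op_trace_add: "op_trace (S + T) = op_trace S + op_trace T"
  by (simp add: op_trace_def Let_def app_plus cinner_add_right sum.distrib)
lemma op_trace_scaleC: "op_trace (c *\<^sub>C T) = c * op_trace T"
  by (simp add: op_trace_def Let_def app_scale cinner_scaleC_right sum_distrib_left)
lemma op_trace_sum: "op_trace (\<Sum>i\<in>A. f i) = (\<Sum>i\<in>A. op_trace (f i))"
proof -
  have "op_trace (0::'a linop) = 0" using op_trace_scaleC[of 0 "0::'a linop"] by simp
  then show ?thesis by (induction A rule: infinite_finite_induct) (simp_all add: op_trace_add)
qed

definition ketbra :: "'a::fd_hilbert \<Rightarrow> 'a \<Rightarrow> 'a linop" where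
  "ketbra u v = Linop (\<lambda>x. cinner v x *\<^sub>C u)"
lemma app_ketbra: "app (ketbra u v) x = cinner v x *\<^sub>C u"
  unfolding ketbra_def by (subst Linop_inverse)
    (auto simp: clinear_iff cinner_add_right scaleC_add_left cinner_scaleC_right scaleC_scaleC)

lemma op_trace_ketbra: "op_trace (T * ketbra u v) = cinner v (app T u)"
proof -
  obtain E :: "'a set" where E: "is_onb E" using onb_exists by blast
  have "op_trace (T * ketbra u v) = (\<Sum>e\<in>E. cinner e (app T u) * cinner v e)"
    by (simp add: op_trace_onb[OF E] app_times app_ketbra cinner_scaleC_right mult.commute)
  also have "\<dots> = cinner v (\<Sum>e\<in>E. cinner e (app T u) *\<^sub>C e)"
    by (simp add: cinner_sum_right cinner_scaleC_right)
  also have "\<dots> = cinner v (app T u)" using onb_expansion[OF E, of "app T u"] by simp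
  finally show ?thesis .
qed
lemma op_trace_commute: "op_trace (S * T) = op_trace (T * S)"
proof -
  obtain E :: "'a set" where E: "is_onb E" using onb_exists by blast
  show ?thesis using onb_trace_swap[OF E E] by (simp add: op_trace_onb[OF E] app_times)
qed

lemma app_linop_sum: "app (\<Sum>i\<in>A. f i) x = (\<Sum>i\<in>A. app (f i) x)"
proof -
  have "app 0 x = 0" by transfer simp
  then show ?thesis by (induction A rule: infinite_finite_induct) (simp_all add: app_plus)
qed

lemma linop_expansion:
  assumes "is_onb E"
  shows "T = (\<Sum>e\<in>E. \<Sum>f\<in>E. cinner e (app T f) *\<^sub>C ketbra e f)"
proof (rule linop_eqI)
  fix x
  have "app T x = (\<Sum>f\<in>E. cinner f x *\<^sub>C app T f)"
    by (subst onb_expansion[OF assms, of x]) (simp only: app_sum app_scaleC)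
  also have "\<dots> = (\<Sum>f\<in>E. cinner f x *\<^sub>C (\<Sum>e\<in>E. cinner e (app T f) *\<^sub>C e))"
    by (simp only: onb_expansion[OF assms, symmetric])
  also have "\<dots> = (\<Sum>f\<in>E. \<Sum>e\<in>E. (cinner e (app T f) * cinner f x) *\<^sub>C e)"
    by (simp add: complex_vector.scale_sum_right scaleC_scaleC mult.commute)
  also have "\<dots> = (\<Sum>e\<in>E. \<Sum>f\<in>E. (cinner e (app T f) * cinner f x) *\<^sub>C e)"
    by (rule sum.swap)
  finally show "app T x = app (\<Sum>e\<in>E. \<Sum>f\<in>E. cinner e (app T f) *\<^sub>C ketbra e f) x"
    by (simp add: app_linop_sum app_scale app_ketbra scaleC_scaleC)
qed

lemma dual_map_ex1:
  fixes \<Phi> :: "'a::fd_hilbert linop \<Rightarrow> 'b::fd_hilbert linop"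
  assumes "clinear \<Phi>"
  shows "\<exists>!\<Psi>. clinear \<Psi> \<and> (\<forall>X \<rho>. op_trace (\<rho> * \<Psi> X) = op_trace (\<Phi> \<rho> * X))"
proof (rule ex_ex1I)
  obtain E :: "'a set" where E: "is_onb E" using onb_exists by blast
  define \<Psi> where "\<Psi> X = (\<Sum>e\<in>E. \<Sum>f\<in>E. op_trace (\<Phi> (ketbra f e) * X) *\<^sub>C ketbra e f)" for X
  have s: "S * (c *\<^sub>C T) = c *\<^sub>C (S * T)" for S T :: "'c::complex_vector linop" and c
    by (rule linop_eqI) (simp add: app_times app_scale)
  have s': "(c *\<^sub>C S) * T = c *\<^sub>C (S * T)" for S T :: "'c::complex_vector linop" and c
    by (rule linop_eqI) (simp add: app_times app_scale)
  have l: "clinear \<Psi>"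
    unfolding clinear_iff by (simp add: \<Psi>_def distrib_left op_trace_add op_trace_scaleC s
      scaleC_add_left sum.distrib complex_vector.scale_sum_right scaleC_scaleC)
  have pa: "\<Phi> (x + y) = \<Phi> x + \<Phi> y" and pc: "\<Phi> (c *\<^sub>C x) = c *\<^sub>C \<Phi> x" for x y c
    using assms by (auto simp: clinear_iff)
  have ps: "\<Phi> (\<Sum>i\<in>A. g i) = (\<Sum>i\<in>A. \<Phi> (g i))" for A and g :: "'a \<Rightarrow> 'a linop"
  proof -
    have "\<Phi> 0 = 0" using pc[of 0 0] by simp
    then show ?thesis by (induction A rule: infinite_finite_induct) (simp_all add: pa)
  qed
  have "op_trace (\<rho> * \<Psi> X) = op_trace (\<Phi> \<rho> * X)" for X \<rho>
  proof -
    have "\<Phi> \<rho> = (\<Sum>f\<in>E. \<Sum>e\<in>E. cinner f (app \<rho> e) *\<^sub>C \<Phi> (ketbra f e))"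
      by (subst linop_expansion[OF E, of \<rho>]) (simp only: ps pc)
    then have "op_trace (\<Phi> \<rho> * X)
        = (\<Sum>f\<in>E. \<Sum>e\<in>E. cinner f (app \<rho> e) * op_trace (\<Phi> (ketbra f e) * X))"
      by (simp add: sum_distrib_right op_trace_sum s' op_trace_scaleC)
    also have "\<dots> = (\<Sum>e\<in>E. \<Sum>f\<in>E. op_trace (\<Phi> (ketbra f e) * X) * cinner f (app \<rho> e))"
      by (subst sum.swap) (simp add: mult.commute)
    finally have "op_trace (\<Phi> \<rho> * X) = \<dots>" .
    moreover have "op_trace (\<rho> * \<Psi> X)
        = (\<Sum>e\<in>E. \<Sum>f\<in>E. op_trace (\<Phi> (ketbra f e) * X) * cinner f (app \<rho> e))"
      by (simp add: \<Psi>_def sum_distrib_left op_trace_sum s op_trace_scaleC op_trace_ketbra)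
    ultimately show ?thesis by simp
  qed
  then show "\<exists>\<Psi>. clinear \<Psi> \<and> (\<forall>X \<rho>. op_trace (\<rho> * \<Psi> X) = op_trace (\<Phi> \<rho> * X))" using l by blast
next
  fix \<Psi> \<Psi>' :: "'b linop \<Rightarrow> 'a linop"
  assume a: "clinear \<Psi> \<and> (\<forall>X \<rho>. op_trace (\<rho> * \<Psi> X) = op_trace (\<Phi> \<rho> * X))"
    "clinear \<Psi>' \<and> (\<forall>X \<rho>. op_trace (\<rho> * \<Psi>' X) = op_trace (\<Phi> \<rho> * X))"
  show "\<Psi> = \<Psi>'"
  proof (intro ext linop_eqI)
    fix X u
    have "cinner v (app (\<Psi> X) u) = cinner v (app (\<Psi>' X) u)" for v
      unfolding op_trace_ketbra[symmetric] op_trace_commute[of _ "ketbra u v"] using a by simp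
    then have "cinner (app (\<Psi> X) u - app (\<Psi>' X) u) (app (\<Psi> X) u - app (\<Psi>' X) u) = 0"
      by (simp add: cinner_diff_right)
    then show "app (\<Psi> X) u = app (\<Psi>' X) u" by (simp add: cinner_eq_zero_iff)
  qed
qed

section \<open>The spaces \<open>\<complex>\<^sup>n\<close>\<close>

instantiation vec :: (complex_vector, finite) complex_vector
begin
definition "scaleC_vec c x = (\<chi> i. c *\<^sub>C (x $ i))"
instance
  by standard (simp_all add: scaleC_vec_def vec_eq_iff scaleC_add_right scaleC_add_left scaleC_scaleC scaleC_one)
end

instantiation complex :: fd_hilbert
begin
definition "scaleC_complex c (x::complex) = c * x"
definition "cinner_complex (x::complex) y = cnj x * y"
instance
proof
  show "\<exists>B::complex set. finite B \<and> (\<forall>x. \<exists>c. x = (\<Sum>b\<in>B. c b *\<^sub>C b))"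
    by (intro exI[of _ "{1}"]) (auto simp: scaleC_complex_def)
qed (simp_all add: scaleC_complex_def cinner_complex_def algebra_simps)
end

instantiation vec :: (fd_hilbert, finite) fd_hilbert
begin
definition "cinner_vec x y = (\<Sum>i\<in>UNIV. cinner (x $ i) (y $ i))"
instance
proof
  fix x y z :: "'a^'b" and a
  show "cinner x y = cnj (cinner y x)"
    by (simp add: cinner_vec_def cinner_commute[symmetric])
  show "cinner x (y + z) = cinner x y + cinner x z"
    by (simp add: cinner_vec_def cinner_add_right sum.distrib)
  show "cinner x (a *\<^sub>C y) = a * cinner x y"
    by (simp add: cinner_vec_def scaleC_vec_def cinner_scaleC_right sum_distrib_left)
  show "0 \<le> Re (cinner x x)" by (simp add: cinner_vec_def cinner_nonneg sum_nonneg)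
  show "cinner x x = 0 \<longleftrightarrow> x = 0"
  proof
    assume "cinner x x = 0"
    then have "(\<Sum>i\<in>UNIV. Re (cinner (x $ i) (x $ i))) = 0"
      by (simp add: cinner_vec_def flip: Re_sum)
    then have "Re (cinner (x $ i) (x $ i)) = 0" for i
      by (simp add: sum_nonneg_eq_0_iff cinner_nonneg)
    then show "x = 0" by (metis cinner_self cinner_eq_zero_iff of_real_0 vec_eq_iff zero_index)
  qed (simp add: cinner_vec_def)
  obtain B :: "'a set" where B: "finite B" "is_onb B" using onb_exists is_onb_def by blast
  define D where "D = (\<lambda>(i::'b, b). axis i b) ` (UNIV \<times> B)"
  have "x \<in> cspan D" for x
  proof -
    have "axis i v \<in> cspan D" for i v
    proof -
      have "axis i v = (\<Sum>e\<in>B. cinner e v *\<^sub>C axis i e)"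
        by (subst onb_expansion[OF B(2), of v]) (auto simp: vec_eq_iff axis_def scaleC_vec_def)
      moreover have "axis i e \<in> cspan D" if "e \<in> B" for e
        using that by (intro complex_vector.span_base) (auto simp: D_def)
      ultimately show ?thesis by (simp add: complex_vector.span_sum complex_vector.span_scale)
    qed
    moreover have "x = (\<Sum>i\<in>UNIV. axis i (x $ i))"
      by (simp add: vec_eq_iff axis_def)
    ultimately show ?thesis by (metis complex_vector.span_sum)
  qed
  moreover have fD: "finite D" using B by (simp add: D_def)
  ultimately show "\<exists>B::('a^'b) set. finite B \<and> (\<forall>x. \<exists>c. x = (\<Sum>b\<in>B. c b *\<^sub>C b))"
    by (intro exI[of _ D]) (auto simp: complex_vector.span_finite[OF fD])
qed
end

end

theory Submission
  imports Defs
begin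

text \<open>
  Since \<open>Tr (\<Phi> \<rho> X) = Tr (\<rho> \<Phi>\<^sup>\<dagger>(X))\<close>, testing privacy on the pure states of \<open>C\<close> says that the
  quadratic form of \<open>\<Phi>\<^sup>\<dagger>(X)\<close> is constant on the unit vectors of \<open>C\<close>, which by polarization means
  that its compression to \<open>C\<close> is scalar. Conversely, if the compression is \<open>\<lambda>\<^sub>X P\<close>, then
  \<open>Tr (\<Phi> \<rho> X) = \<lambda>\<^sub>X\<close> for every state \<open>\<rho>\<close> on \<open>C\<close>, and the functionals \<open>Tr (\<cdot> X)\<close> separate operators.
\<close>

lemma cinner_eqI:
  fixes x y :: "'a::fd_hilbert"
  assumes "\<And>z. cinner z x = cinner z y"
  shows "x = y"
proof -
  have "cinner (x - y) (x - y) = 0" using assms by (simp add: cinner_diff_right)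
  then show ?thesis by (simp add: cinner_eq_zero_iff)
qed

text \<open>The rank-one choices \<open>X = ketbra u v\<close> turn the traces into the matrix
  coefficients \<open>cinner v (app S u)\<close>.\<close>

lemma linop_eqI_trace:
  assumes "\<And>X. op_trace (S * X) = op_trace (T * X)"
  shows "S = T"
  using assms by (metis cinner_eqI linop_eqI op_trace_ketbra)

lemma times_scaleC_linop: "S * (c *\<^sub>C T) = c *\<^sub>C (S * T :: 'a::complex_vector linop)"
  by (rule linop_eqI) (simp add: app_times app_scale)

lemma op_trace_dual_map:
  assumes "clinear \<Phi>"
  shows "op_trace (\<rho> * dual_map \<Phi> X) = op_trace (\<Phi> \<rho> * X)"
  using theI'[OF dual_map_ex1[OF assms]] unfolding dual_map_def by blast

lemma orth_proj_props:
  assumes "csubspace C"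
  shows orth_proj_in: "app (orth_proj C) x \<in> C"
    and cinner_orth_proj_right: "z \<in> C \<Longrightarrow> cinner z (app (orth_proj C) x) = cinner z x"
proof -
  have "\<forall>x. app (orth_proj C) x \<in> C \<and> (\<forall>z\<in>C. cinner z (x - app (orth_proj C) x) = 0)"
    unfolding orth_proj_def by (rule theI'[OF orth_proj_ex1[OF assms]])
  then show "app (orth_proj C) x \<in> C"
    and "z \<in> C \<Longrightarrow> cinner z (app (orth_proj C) x) = cinner z x"
    by (blast, metis cinner_diff_right eq_iff_diff_eq_0)
qed

lemma orth_proj_fixes:
  assumes "csubspace C" "x \<in> C"
  shows "app (orth_proj C) x = x"
proof -
  let ?d = "x - app (orth_proj C) x"
  have "?d \<in> C"
    using assms orth_proj_in complex_vector.subspace_diff by blast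
  then have "cinner ?d ?d = 0"
    by (subst cinner_diff_right) (simp add: cinner_orth_proj_right[OF assms(1)])
  then show ?thesis by (simp add: cinner_eq_zero_iff)
qed

lemma cinner_orth_proj_left:
  assumes "csubspace C" "z \<in> C"
  shows "cinner (app (orth_proj C) x) z = cinner x z"
  using cinner_orth_proj_right[OF assms] by (metis cinner_commute)

lemma orth_proj_idem:
  assumes "csubspace C"
  shows "orth_proj C * orth_proj C = orth_proj C"
  by (rule linop_eqI) (simp add: app_times orth_proj_fixes orth_proj_in assms)

text \<open>The sesquilinear form \<open>B\<close> vanishes on the diagonal of \<open>C\<close>. It
  need not be Hermitian, so \<open>B v u\<close> and \<open>B u v\<close> are separate unknowns;
  \<open>c = 1\<close> and \<open>c = \<i>\<close> give two equations for them.\<close>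

lemma polarization:
  fixes T :: "'a::fd_hilbert linop"
  assumes "csubspace C" "u \<in> C" "v \<in> C"
    and q: "\<And>w. w \<in> C \<Longrightarrow> cinner w (app T w) = l * cinner w w"
  shows "cinner v (app T u) = l * cinner v u"
proof -
  define B where "B x y = cinner x (app T y) - l * cinner x y" for x y
  have B0: "B w w = 0" if "w \<in> C" for w using q[OF that] by (simp add: B_def)
  have c: "c * B v u + cnj c * B u v = 0" for c
  proof -
    have "v + c *\<^sub>C u \<in> C"
      using assms by (simp add: complex_vector.subspace_add complex_vector.subspace_scale)
    then have "0 = B (v + c *\<^sub>C u) (v + c *\<^sub>C u)" by (simp only: B0)
    also have "\<dots> = B v v + c * B v u + cnj c * B u v + cnj c * c * B u u"
      by (simp add: B_def cinner_add_left cinner_add_right cinner_scaleC_left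
          cinner_scaleC_right algebra_simps)
    finally show ?thesis by (simp add: B0 assms)
  qed
  have "\<i> * (B v u - B u v) = 0" using c[of \<i>] by (simp add: algebra_simps)
  moreover have "B v u + B u v = 0" using c[of 1] by simp
  ultimately have "B v u = 0" by simp
  then show ?thesis by (simp add: B_def)
qed

text \<open>The projection is self-adjoint, so coefficients of the compression are coefficients of
  \<open>T\<close> at projected vectors, where \<open>polarization\<close> applies.\<close>

lemma compression_scalar:
  fixes T :: "'a::fd_hilbert linop"
  assumes C: "csubspace C"
    and q: "\<And>w. w \<in> C \<Longrightarrow> cinner w (app T w) = l * cinner w w"
  shows "orth_proj C * T * orth_proj C = l *\<^sub>C orth_proj C"
proof (rule linop_eqI, rule cinner_eqI)
  fix x z
  let ?p = "app (orth_proj C)"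
  have "cinner z (?p (app T (?p x))) = cinner (?p z) (?p (app T (?p x)))"
    by (rule cinner_orth_proj_left[OF C orth_proj_in[OF C], symmetric])
  also have "\<dots> = cinner (?p z) (app T (?p x))"
    by (rule cinner_orth_proj_right[OF C orth_proj_in[OF C]])
  also have "\<dots> = l * cinner (?p z) (?p x)"
    by (rule polarization[OF C orth_proj_in[OF C] orth_proj_in[OF C] q])
  also have "\<dots> = l * cinner z (?p x)"
    by (simp only: cinner_orth_proj_left[OF C orth_proj_in[OF C]])
  finally show "cinner z (app (orth_proj C * T * orth_proj C) x)
      = cinner z (app (l *\<^sub>C orth_proj C) x)"
    by (simp only: app_times app_scale cinner_scaleC_right)
qed

text \<open>Normalizing here lets any nonzero vector of \<open>C\<close> serve without rescaling. At
  \<open>u = 0\<close> the value is the zero operator.\<close>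

definition pure_state :: "'a::fd_hilbert \<Rightarrow> 'a linop" where
  "pure_state u = (1 / cinner u u) *\<^sub>C ketbra u u"

lemma pure_state_in_ops_on:
  assumes "csubspace C" "u \<in> C"
  shows "pure_state u \<in> ops_on C"
proof -
  have "pure_state u = orth_proj C * pure_state u * orth_proj C"
    by (rule linop_eqI) (simp add: pure_state_def app_times app_scale app_ketbra
        orth_proj_fixes[OF assms] cinner_orth_proj_right[OF assms])
  then show ?thesis unfolding ops_on_def by (rule CollectI)
qed

lemma op_trace_times_pure_state: "op_trace (T * pure_state u) = cinner u (app T u) / cinner u u"
  by (simp add: pure_state_def times_scaleC_linop op_trace_scaleC op_trace_ketbra)

lemma density_op_pure_state:
  assumes "u \<noteq> 0"
  shows "density_op (pure_state u)"
  unfolding density_op_def psd_def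
proof (intro conjI allI)
  fix x
  have "cinner u x * cinner x u = complex_of_real ((cmod (cinner u x))\<^sup>2)"
    unfolding complex_norm_square by (simp only: cinner_commute[of x u])
  then have "cinner x (app (pure_state u) x)
      = complex_of_real ((cmod (cinner u x))\<^sup>2 / Re (cinner u u))"
    by (subst of_real_divide, subst cinner_self[symmetric])
      (simp add: pure_state_def app_scale app_ketbra cinner_scaleC_right)
  then show "cinner x (app (pure_state u) x) \<in> \<real>\<^sub>\<ge>\<^sub>0"
    by (simp only: nonneg_Reals_of_real_iff) (simp add: cinner_nonneg)
next
  \<comment> \<open>The projection onto the whole space acts as the identity, making the trace an
    instance of \<open>op_trace_times_pure_state\<close>.\<close>
  let ?P = "orth_proj (UNIV :: 'a set)"
  have P: "app ?P x = x" for x by (simp add: orth_proj_fixes)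
  then have "?P * pure_state u = pure_state u" by (intro linop_eqI) (simp add: app_times)
  then show "op_trace (pure_state u) = 1"
    using op_trace_times_pure_state[of ?P u] assms by (simp add: P cinner_eq_zero_iff)
qed

text \<open>Positivity is complete positivity at block size 1.\<close>

lemma psd_completely_positive:
  assumes "completely_positive \<Phi>" "psd \<rho>"
  shows "psd (\<Phi> \<rho>)"
proof -
  have "block_psd 1 (\<lambda>i j. \<rho>)" using assms(2) by (simp add: block_psd_def psd_def)
  then have b: "block_psd 1 (\<lambda>i j. \<Phi> \<rho>)" using assms(1) by (auto simp: completely_positive_def)
  show ?thesis unfolding psd_def
  proof
    fix x
    show "cinner x (app (\<Phi> \<rho>) x) \<in> \<real>\<^sub>\<ge>\<^sub>0"
      using b[unfolded block_psd_def, rule_format, of "\<lambda>_. x"] by simp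
  qed
qed

lemma density_op_channel:
  assumes "completely_positive \<Phi>" "trace_preserving \<Phi>" "density_op \<rho>"
  shows "density_op (\<Phi> \<rho>)"
  using assms psd_completely_positive by (auto simp: density_op_def trace_preserving_def)

text \<open>Duality gives the trace of \<open>\<rho> * dual_map \<Phi> X\<close>; since
  \<open>\<rho>\<close> absorbs the projection on both sides, cyclicity puts the compression in
  place of the dual image.\<close>

lemma op_trace_channel_scalar_compression:
  assumes \<Phi>: "clinear \<Phi>" and C: "csubspace C" and \<rho>: "\<rho> \<in> ops_on C" "op_trace \<rho> = 1"
    and l: "orth_proj C * dual_map \<Phi> X * orth_proj C = l *\<^sub>C orth_proj C"
  shows "op_trace (\<Phi> \<rho> * X) = l"
proof -
  let ?P = "orth_proj C" and ?M = "dual_map \<Phi> X"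
  have e: "\<rho> = ?P * \<rho> * ?P" using \<rho>(1) unfolding ops_on_def by (rule CollectD)
  have "?P * \<rho> * ?P * ?P = ?P * \<rho> * ?P" by (simp add: mult.assoc orth_proj_idem[OF C])
  then have "\<rho> * ?P = \<rho>" by (simp only: e[symmetric])
  have "op_trace (\<Phi> \<rho> * X) = op_trace (?P * (\<rho> * ?P * ?M))"
    by (simp only: op_trace_dual_map[OF \<Phi>, symmetric] mult.assoc[symmetric] e[symmetric])
  also have "\<dots> = op_trace (\<rho> * (?P * ?M * ?P))"
    by (subst op_trace_commute) (simp add: mult.assoc)
  also have "\<dots> = l" using \<open>\<rho> * ?P = \<rho>\<close> \<rho>(2)
    by (simp add: l times_scaleC_linop op_trace_scaleC)
  finally show ?thesis .
qed

lemma private_imp_scalar_compression: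
  assumes \<Phi>: "clinear \<Phi>" and C: "csubspace C" and out: "output_state \<Phi> C \<rho>\<^sub>0"
  shows "orth_proj C * dual_map \<Phi> X * orth_proj C = op_trace (\<rho>\<^sub>0 * X) *\<^sub>C orth_proj C"
proof (rule compression_scalar[OF C])
  fix w assume w: "w \<in> C"
  show "cinner w (app (dual_map \<Phi> X) w) = op_trace (\<rho>\<^sub>0 * X) * cinner w w"
  \<comment> \<open>Only a nonzero \<open>w\<close> gives a pure state; its image under
    \<open>\<Phi>\<close> is \<open>\<rho>\<^sub>0\<close>, and duality reads off the quadratic
    form.\<close>
  proof (cases "w = 0")
    case False
    then have "\<Phi> (pure_state w) = \<rho>\<^sub>0"
      using out density_op_pure_state[of w] pure_state_in_ops_on[OF C w] by (simp add: output_state_def)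
    then have "op_trace (\<rho>\<^sub>0 * X) = cinner w (app (dual_map \<Phi> X) w) / cinner w w"
      using op_trace_dual_map[OF \<Phi>, of "pure_state w" X]
        op_trace_commute[of "pure_state w" "dual_map \<Phi> X"]
        op_trace_times_pure_state[of "dual_map \<Phi> X" w] by simp
    then show ?thesis using False by (simp add: cinner_eq_zero_iff)
  qed simp
qed

theorem theorem3p1:
  fixes \<Phi> :: "'a::fd_hilbert linop \<Rightarrow> 'b::fd_hilbert linop" and C :: "'a set"
  assumes "clinear \<Phi>" and "completely_positive \<Phi>" and "trace_preserving \<Phi>"
    and "csubspace C" and "C \<noteq> {0}"
  shows "(private_subspace \<Phi> C \<longleftrightarrow>
            (\<forall>X. \<exists>l. orth_proj C * dual_map \<Phi> X * orth_proj C = l *\<^sub>C orth_proj C))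
       \<and> (\<forall>\<rho>\<^sub>0. output_state \<Phi> C \<rho>\<^sub>0 \<longrightarrow>
            (\<forall>X l. orth_proj C * dual_map \<Phi> X * orth_proj C = l *\<^sub>C orth_proj C
                   \<longrightarrow> l = op_trace (\<rho>\<^sub>0 * X)))"
proof -
  note \<Phi> = assms(1) and C = assms(4)
  obtain u where u: "u \<in> C" "u \<noteq> 0"
    using assms(5) complex_vector.subspace_0[OF C] by blast
  \<comment> \<open>One fixed state on \<open>C\<close> has two uses: its image is the candidate
    output state, and it later forces the value of the scalar.\<close>
  define \<sigma> where "\<sigma> = pure_state u"
  have \<sigma>: "\<sigma> \<in> ops_on C" "density_op \<sigma>"
    using u C by (simp_all add: \<sigma>_def pure_state_in_ops_on density_op_pure_state)
  have tr: "op_trace (\<Phi> \<rho> * X) = l"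
    if "\<rho> \<in> ops_on C" "density_op \<rho>"
      "orth_proj C * dual_map \<Phi> X * orth_proj C = l *\<^sub>C orth_proj C" for \<rho> X l
    using that by (intro op_trace_channel_scalar_compression[OF \<Phi> C]) (auto simp: density_op_def)
  have "private_subspace \<Phi> C"
    if s: "\<forall>X. \<exists>l. orth_proj C * dual_map \<Phi> X * orth_proj C = l *\<^sub>C orth_proj C"
  proof -
    have "\<Phi> \<rho> = \<Phi> \<sigma>" if "\<rho> \<in> ops_on C" "density_op \<rho>" for \<rho>
      \<comment> \<open>For each \<open>X\<close> both traces equal the same scalar supplied by
        \<open>s\<close>.\<close>
      by (rule linop_eqI_trace) (metis s tr that \<sigma>)
    then have "output_state \<Phi> C (\<Phi> \<sigma>)"
      using density_op_channel[OF assms(2,3) \<sigma>(2)] by (simp add: output_state_def)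
    then show ?thesis by (auto simp: private_subspace_def)
  qed
  moreover have "\<exists>l. orth_proj C * dual_map \<Phi> X * orth_proj C = l *\<^sub>C orth_proj C"
    if "private_subspace \<Phi> C" for X
    using that private_imp_scalar_compression[OF \<Phi> C] by (auto simp: private_subspace_def)
  \<comment> \<open>Both sides equal the trace of \<open>\<Phi> \<sigma> * X\<close>.\<close>
  moreover have "l = op_trace (\<rho>\<^sub>0 * X)"
    if "output_state \<Phi> C \<rho>\<^sub>0" "orth_proj C * dual_map \<Phi> X * orth_proj C = l *\<^sub>C orth_proj C" for \<rho>\<^sub>0 X l
    using tr[OF \<sigma> that(2)] that(1) \<sigma> by (simp add: output_state_def)
  ultimately show ?thesis by blast
qed

end
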